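(* Let $q\ge3$ be an integer and $0\le\beta<1$. Let $\mathcal{G}$ be a family of finite graphs such that (i) the function $\delta$ defined by $\delta(d)=\frac{2(1-\beta)}{q-1-(1-\beta)d}$ if $d\le\frac{q-1}{1-\beta}-2$ and $\delta(d)=1$ otherwise, is a contraction function for $\mathcal{G}$; and (ii) if $\beta=0$, every graph in $\mathcal{G}$ is properly $q$-colorable. Then the $q$-state Potts model with activity $\beta$ exhibits strong spatial mixing on all graphs in $\mathcal{G}$: there exist constants $C>0$ and $0<\gamma<1$ such that for every $G=(V,E)\in\mathcal{G}$ with $n=|V|$, every $v\in V$, every $\Lambda\subseteq V$, every $x\in[q]$, and every $\sigma,\tau\in[q]^\Lambda$ such that $\Omega_1=(G,\Lambda,\sigma)$ and $\Omega_2=(G,\Lambda,\tau)$ are both feasible, $$\left|\Pr_{\Omega_1}[c(v)=x]-\Pr_{\Omega_2}[c(v)=x]\right|\le n^C\gamma^{\mathrm{dist}_G(v,D)},$$ where $D\subseteq\Lambda$ is the set of vertices on which $\sigma$ and $\tau$ differ.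
   Context: Potts model: fix an integer $q\ge2$ and a real $\beta\ge0$ (activity); $[q]=\{1,\dots,q\}$ and $0^0=1$. For a finite undirected graph $G=(V,E)$, an instance is a triple $\Omega=(G,\Lambda,\sigma)$ with $\Lambda\subseteq V$ and $\sigma\in[q]^\Lambda$. For $\pi\in[q]^V$, $w_\Omega(\pi)=\beta^{|\{uv\in E:\pi(u)=\pi(v)\}|}$ if $\pi$ agrees with $\sigma$ on $\Lambda$, and $w_\Omega(\pi)=0$ otherwise. $\Omega$ is feasible if some $\pi$ has $w_\Omega(\pi)>0$; then $Z(\Omega)=\sum_{\pi\in[q]^V}w_\Omega(\pi)$ and the Gibbs measure is $\Pr_\Omega[c(V)=\pi]=w_\Omega(\pi)/Z(\Omega)$ ($c$ is the random configuration); $\Pr_\Omega[c(v)=x]$ and $\Pr_\Omega[c(S)=\pi]$ are its marginals. $\mathrm{dist}_G(v,D)$ is the minimum graph distance from $v$ to a vertex of $D$ (taken to be $+\infty$ if $D=\emptyset$ or no vertex of $D$ is reachable, with $\gamma^{+\infty}=0$). Self-avoiding walks and contraction function: $\mathsf{SAW}(v,\ell)$ is the set of self-avoiding walks $(v,v_1,\dots,v_\ell)$ in $G$ with $\ell$ edges from $v$; $\mathcal{E}_\delta(v,\ell)=\sum_{(v,v_1,\dots,v_\ell)\in\mathsf{SAW}(v,\ell)}\prod_{i=1}^\ell\delta(\deg_G(v_i))$; $\delta:\mathbb{N}\to\mathbb{R}^+$ is a contraction function for a family $\mathcal{G}$ if there are constants $C>0$, $0<\gamma<1$ with $\mathcal{E}_\delta(v,\ell)<n^C\gamma^\ell$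 for every $G=(V,E)\in\mathcal{G}$, $n=|V|$, every vertex $v$ and every $\ell\ge1$. *)

theory Defs
  imports "HOL-Analysis.Analysis" "HOL-Library.Extended_Nat"
begin

definition graph :: "'a set \<Rightarrow> 'a set set \<Rightarrow> bool" where
  "graph V E \<longleftrightarrow> finite V \<and> (\<forall>e\<in>E. \<exists>u v. e = {u, v} \<and> u \<noteq> v \<and> u \<in> V \<and> v \<in> V)"

definition adj :: "'a set set \<Rightarrow> 'a \<Rightarrow> 'a \<Rightarrow> bool" where
  "adj E u v \<longleftrightarrow> {u, v} \<in> E \<and> u \<noteq> v"

definition deg :: "'a set set \<Rightarrow> 'a \<Rightarrow> nat" where
  "deg E v = card {e \<in> E. v \<in> e}"

definition is_walk :: "'a set \<Rightarrow> 'a set set \<Rightarrow> 'a list \<Rightarrow> bool" where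
  "is_walk V E xs \<longleftrightarrow> xs \<noteq> [] \<and> set xs \<subseteq> V \<and>
     (\<forall>i. Suc i < length xs \<longrightarrow> adj E (xs ! i) (xs ! Suc i))"

definition SAW :: "'a set \<Rightarrow> 'a set set \<Rightarrow> 'a \<Rightarrow> nat \<Rightarrow> 'a list set" where
  "SAW V E v l = {xs. is_walk V E xs \<and> distinct xs \<and> length xs = Suc l \<and> hd xs = v}"

definition Edelta :: "(nat \<Rightarrow> real) \<Rightarrow> 'a set \<Rightarrow> 'a set set \<Rightarrow> 'a \<Rightarrow> nat \<Rightarrow> real" where
  "Edelta \<delta> V E v l = (\<Sum>xs\<in>SAW V E v l. \<Prod>i\<in>{1..l}. \<delta> (deg E (xs ! i)))"

definition contraction_function :: "(nat \<Rightarrow> real) \<Rightarrow> ('a set \<times> 'a set set) set \<Rightarrow> bool" where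
  "contraction_function \<delta> \<G> \<longleftrightarrow> (\<forall>d. \<delta> d > 0) \<and>
     (\<exists>C::real. \<exists>\<gamma>::real. C > 0 \<and> 0 < \<gamma> \<and> \<gamma> < 1 \<and>
        (\<forall>(V, E)\<in>\<G>. \<forall>v\<in>V. \<forall>l\<ge>1.
           Edelta \<delta> V E v l < real (card V) powr C * \<gamma> ^ l))"

definition dist_to :: "'a set \<Rightarrow> 'a set set \<Rightarrow> 'a \<Rightarrow> 'a set \<Rightarrow> enat" where
  "dist_to V E v D =
     (if \<exists>xs. is_walk V E xs \<and> hd xs = v \<and> last xs \<in> D
      then enat (LEAST k. \<exists>xs. is_walk V E xs \<and> hd xs = v \<and> last xs \<in> D \<and> length xs = Suc k)
      else \<infinity>)"

definition epow :: "real \<Rightarrow> enat \<Rightarrow> real" where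
  "epow \<gamma> d = (case d of enat k \<Rightarrow> \<gamma> ^ k | \<infinity> \<Rightarrow> 0)"

definition configs :: "nat \<Rightarrow> 'a set \<Rightarrow> ('a \<Rightarrow> nat) set" where
  "configs q V = (V \<rightarrow>\<^sub>E {1..q})"

definition mono_edges :: "'a set set \<Rightarrow> ('a \<Rightarrow> nat) \<Rightarrow> 'a set set" where
  "mono_edges E \<pi> = {e \<in> E. \<exists>u v. e = {u, v} \<and> u \<noteq> v \<and> \<pi> u = \<pi> v}"

(* Potts weight of pi in the instance (G, Lambda, sigma); note 0 ^ 0 = 1 *)
definition potts_weight :: "real \<Rightarrow> 'a set set \<Rightarrow> 'a set \<Rightarrow> ('a \<Rightarrow> nat) \<Rightarrow> ('a \<Rightarrow> nat) \<Rightarrow> real" where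
  "potts_weight \<beta> E \<Lambda> \<sigma> \<pi> =
     (if \<forall>u\<in>\<Lambda>. \<pi> u = \<sigma> u then \<beta> ^ card (mono_edges E \<pi>) else 0)"

definition feasible :: "nat \<Rightarrow> real \<Rightarrow> 'a set \<Rightarrow> 'a set set \<Rightarrow> 'a set \<Rightarrow> ('a \<Rightarrow> nat) \<Rightarrow> bool" where
  "feasible q \<beta> V E \<Lambda> \<sigma> \<longleftrightarrow> (\<exists>\<pi>\<in>configs q V. potts_weight \<beta> E \<Lambda> \<sigma> \<pi> > 0)"

definition partition_fn :: "nat \<Rightarrow> real \<Rightarrow> 'a set \<Rightarrow> 'a set set \<Rightarrow> 'a set \<Rightarrow> ('a \<Rightarrow> nat) \<Rightarrow> real" where
  "partition_fn q \<beta> V E \<Lambda> \<sigma> = (\<Sum>\<pi>\<in>configs q V. potts_weight \<beta> E \<Lambda> \<sigma> \<pi>)"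

definition marginal :: "nat \<Rightarrow> real \<Rightarrow> 'a set \<Rightarrow> 'a set set \<Rightarrow> 'a set \<Rightarrow> ('a \<Rightarrow> nat) \<Rightarrow> 'a \<Rightarrow> nat \<Rightarrow> real" where
  "marginal q \<beta> V E \<Lambda> \<sigma> v x =
     (\<Sum>\<pi>\<in>{\<pi>\<in>configs q V. \<pi> v = x}. potts_weight \<beta> E \<Lambda> \<sigma> \<pi>) / partition_fn q \<beta> V E \<Lambda> \<sigma>"

definition proper_colorable :: "nat \<Rightarrow> 'a set \<Rightarrow> 'a set set \<Rightarrow> bool" where
  "proper_colorable q V E \<longleftrightarrow> (\<exists>\<pi>\<in>configs q V. \<forall>u v. adj E u v \<longrightarrow> \<pi> u \<noteq> \<pi> v)"

definition delta_potts :: "nat \<Rightarrow> real \<Rightarrow> nat \<Rightarrow> real" where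
  "delta_potts q \<beta> d =
     (if real d \<le> (real q - 1) / (1 - \<beta>) - 2
      then 2 * (1 - \<beta>) / (real q - 1 - (1 - \<beta>) * real d) else 1)"

end

theory Submission
  imports Defs
begin

text \<open>For \<open>\<beta> > 0\<close> every boundary condition is feasible, and a disagreement can be followed along
  self-avoiding walks. Changing the colour pinned at \<open>w\<close> amounts to recolouring the half-edges from
  \<open>w\<close> to its free neighbours one at a time. Recolouring a single half-edge at a free vertex \<open>u\<close> of
  degree \<open>d\<close> moves the marginal at \<open>u\<close> by at most \<open>min 1 ((1 - \<beta>) / (q - (1 - \<beta>) d)) \<le> \<delta> d\<close> in total
  variation; conditionally on the colour of \<open>u\<close> the two systems coincide, so what remains is a change
  of the colour pinned at \<open>u\<close> in a system with one free vertex less. Hence the influence of \<open>w\<close> on \<open>v\<close>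
  is at most the \<open>\<delta>\<close>-weight of the self-avoiding walks from \<open>w\<close> to \<open>v\<close>, and reversing the walks
  compares it with \<open>Edelta\<close> at \<open>v\<close>. For \<open>\<beta> = 0\<close>, where intermediate boundary conditions may be
  infeasible, the inequality follows by letting the activity tend to \<open>0\<close> from above while keeping
  \<open>\<delta>\<close> fixed: the marginals are continuous there because the two given instances are feasible.\<close>

section \<open>Moving a penalty factor between two points of a weighted mean\<close>

text \<open>The penalised point is \<open>c\<close> in one mean and \<open>c'\<close> in the other.
  Since \<open>r c' \<le> r c\<close>, the normaliser \<open>N c\<close> is the smaller one, so
  every point other than \<open>c\<close> has at least as much probability under \<open>p c\<close>
  as under \<open>p c'\<close>. All the mass lost therefore sits at \<open>c\<close>, and the total
  variation distance is just \<open>p c' c - p c c\<close>.\<close>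

lemma reweighted_mean_diff_aux:
  fixes r f :: "'b \<Rightarrow> real" and \<beta> Q K t :: real
  assumes A: "finite A" "c \<in> A" "c' \<in> A" "c \<noteq> c'" and r: "\<And>a. a \<in> A \<Longrightarrow> r a > 0"
    and \<beta>: "0 < \<beta>" "\<beta> < 1" and f: "\<And>a b. a \<in> A \<Longrightarrow> b \<in> A \<Longrightarrow> \<bar>f a - f b\<bar> \<le> K"
    and t: "0 \<le> t" "t < 1 \<Longrightarrow> 1 - \<beta> \<le> t * Q"
    and Q: "\<And>a. a \<in> A \<Longrightarrow> r a * (Q + (1 - \<beta>)) \<le> sum r A"
    and le: "r c' \<le> r c"
  shows "\<bar>(\<Sum>a\<in>A. r a * (if a = c then \<beta> else 1) * f a) / (\<Sum>a\<in>A. r a * (if a = c then \<beta> else 1))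
        - (\<Sum>a\<in>A. r a * (if a = c' then \<beta> else 1) * f a) / (\<Sum>a\<in>A. r a * (if a = c' then \<beta> else 1))\<bar> \<le> t * K"
proof -
  define W where "W \<equiv> \<lambda>c a. r a * (if a = c then \<beta> else 1)"
  define N where "N \<equiv> \<lambda>c. sum (W c) A"
  define p where "p \<equiv> \<lambda>c a. W c a / N c"
  have W: "W d a > 0" if "a \<in> A" for a d using r[OF that] \<beta> by (auto simp: W_def)
  have N: "N d > 0" for d unfolding N_def using A W by (intro sum_pos) auto
  have Neq: "N d = sum r A - (1 - \<beta>) * r d" if "d \<in> A" for d
  proof -
    have "N d = (\<Sum>a\<in>A. r a - (if a = d then (1 - \<beta>) * r a else 0))"
      unfolding N_def W_def by (intro sum.cong) (auto simp: algebra_simps)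
    also have "\<dots> = sum r A - (1 - \<beta>) * r d"
      using A that by (simp add: sum_subtractf)
    finally show ?thesis .
  qed
  have NN: "N c \<le> N c'" using Neq A le \<beta> by simp
  have p1: "sum (p d) A = 1" for d
    using N[of d] by (simp add: p_def N_def flip: sum_divide_distrib)
  have p0: "0 \<le> p d a" if "a \<in> A" for d a using W[OF that] N by (simp add: p_def less_imp_le)
  have pge: "p c' a \<le> p c a" if "a \<in> A" "a \<noteq> c" for a
  proof -
    have "W c' a \<le> W c a" using that \<beta> r[of a] by (auto simp: W_def)
    then show ?thesis unfolding p_def using W[OF that(1)] N NN by (intro frac_le) (auto intro: less_imp_le)
  qed
  have mean: "(\<Sum>a\<in>A. r a * (if a = d then \<beta> else 1) * f a) / (\<Sum>a\<in>A. r a * (if a = d then \<beta> else 1))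
     = (\<Sum>a\<in>A. p d a * f a)" for d
    by (simp add: p_def W_def N_def sum_divide_distrib)
  have gap: "(\<Sum>a\<in>A-{c}. p c a - p c' a) = p c' c - p c c"
    using p1[of c] p1[of c'] A by (simp add: sum.remove sum_subtractf)
  \<comment> \<open>Both distributions have mass 1, so subtracting the constant \<open>f c\<close>
    from \<open>f\<close> is free; it removes the term at \<open>c\<close>, and the remaining
    coefficients are nonnegative by \<open>pge\<close>.\<close>
  have "(\<Sum>a\<in>A. p c a * f a) - (\<Sum>a\<in>A. p c' a * f a) = (\<Sum>a\<in>A. (p c a - p c' a) * (f a - f c))"
    using p1[of c] p1[of c'] by (simp add: algebra_simps sum_subtractf sum.distrib flip: sum_distrib_left)
  also have "\<dots> = (\<Sum>a\<in>A-{c}. (p c a - p c' a) * (f a - f c))"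
    using A by (simp add: sum.remove)
  finally have "\<bar>(\<Sum>a\<in>A. p c a * f a) - (\<Sum>a\<in>A. p c' a * f a)\<bar> \<le> (\<Sum>a\<in>A-{c}. \<bar>(p c a - p c' a) * (f a - f c)\<bar>)"
    by (metis sum_abs)
  also have "\<dots> \<le> (\<Sum>a\<in>A-{c}. (p c a - p c' a) * K)"
    by (intro sum_mono) (auto simp: abs_mult A pge f intro!: mult_mono)
  also have "\<dots> = (p c' c - p c c) * K" by (simp add: gap flip: sum_distrib_right)
  also have "\<dots> \<le> t * K"
  proof (rule mult_right_mono)
    show "0 \<le> K" using f[OF A(2) A(2)] by simp
    show "p c' c - p c c \<le> t"
    proof (cases "t < 1")
      case False
      have "p c' c \<le> sum (p c') A" using A p0 by (intro member_le_sum) auto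
      then show ?thesis using False p1 p0[OF A(2), of c] by simp
    next
      case True
      have Qpos: "Q > 0" using t(2)[OF True] t(1) \<beta> by (smt (verit) mult_nonneg_nonpos)
      \<comment> \<open>The extra \<open>1 - \<beta>\<close> next to \<open>Q\<close> in the
        hypothesis pays for the \<open>(1 - \<beta>) * r c'\<close> missing from
        \<open>N c'\<close>.\<close>
      have rc: "r c * Q \<le> N c'"
        using Q[OF A(2)] Neq[OF A(3)] mult_left_mono[OF le, of "1 - \<beta>"] \<beta> by (simp add: algebra_simps)
      have "r c * \<beta> / N c' \<le> r c * \<beta> / N c"
        using NN N \<beta> r[OF A(2)] by (intro divide_left_mono) auto
      then have "p c' c - p c c \<le> r c / N c' - r c * \<beta> / N c'"
        using A(4) by (simp add: p_def W_def)
      also have "\<dots> = r c * (1 - \<beta>) / N c'" by (simp add: algebra_simps flip: diff_divide_distrib)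
      also have "\<dots> \<le> r c * (t * Q) / N c'"
        using t(2)[OF True] N[of c'] r[OF A(2)] by (intro divide_right_mono mult_left_mono) auto
      also have "\<dots> = t * (r c * Q) / N c'" by simp
      also have "\<dots> \<le> t * N c' / N c'"
        using rc t N[of c'] by (intro divide_right_mono mult_left_mono) auto
      also have "\<dots> = t" using N[of c'] by simp
      finally show ?thesis .
    qed
  qed
  finally show ?thesis unfolding mean .
qed

text \<open>The two points play symmetric roles, so the heavier of them may be taken as
  \<open>c\<close>.\<close>

lemma reweighted_mean_diff:
  fixes r f :: "'b \<Rightarrow> real" and \<beta> Q K t :: real
  assumes A: "finite A" "c \<in> A" "c' \<in> A" and r: "\<And>a. a \<in> A \<Longrightarrow> r a > 0"
    and \<beta>: "0 < \<beta>" "\<beta> < 1" and f: "\<And>a b. a \<in> A \<Longrightarrow> b \<in> A \<Longrightarrow> \<bar>f a - f b\<bar> \<le> K"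
    and t: "0 \<le> t" "t < 1 \<Longrightarrow> 1 - \<beta> \<le> t * Q"
    and Q: "\<And>a. a \<in> A \<Longrightarrow> r a * (Q + (1 - \<beta>)) \<le> sum r A"
  shows "\<bar>(\<Sum>a\<in>A. r a * (if a = c then \<beta> else 1) * f a) / (\<Sum>a\<in>A. r a * (if a = c then \<beta> else 1))
        - (\<Sum>a\<in>A. r a * (if a = c' then \<beta> else 1) * f a) / (\<Sum>a\<in>A. r a * (if a = c' then \<beta> else 1))\<bar> \<le> t * K"
proof -
  have "0 \<le> K" using f[OF A(2) A(2)] by simp
  consider "c = c'" | "c \<noteq> c'" "r c' \<le> r c" | "c' \<noteq> c" "r c \<le> r c'" by fastforce
  then show ?thesis
  proof cases
    case 1 then show ?thesis using \<open>0 \<le> K\<close> t by simp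
  next
    case 2 then show ?thesis using assms by (intro reweighted_mean_diff_aux) auto
  next
    case 3
    show ?thesis
      by (subst abs_minus_commute) (rule reweighted_mean_diff_aux[of A c' c r \<beta> f K t Q]; (fact | use assms 3 in auto))
  qed
qed

section \<open>Configurations and monochromatic edges\<close>

lemma adj_sym: "adj E u v \<longleftrightarrow> adj E v u"
  by (auto simp: adj_def insert_commute)

lemma finite_configs: "finite U \<Longrightarrow> finite (configs q U)"
  by (simp add: configs_def finite_PiE)

lemma sum_configs_insert:
  assumes "u \<notin> U"
  shows "(\<Sum>\<pi>\<in>configs q (insert u U). F \<pi>) = (\<Sum>a\<in>{1..q}. \<Sum>\<pi>\<in>configs q U. F (\<pi>(u := a)))"
proof -
  have "configs q (insert u U) = (\<lambda>(a, \<pi>). \<pi>(u := a)) ` ({1..q} \<times> configs q U)"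
    by (simp add: configs_def PiE_insert_eq)
  moreover have "inj_on (\<lambda>(a, \<pi>). \<pi>(u := a)) ({1..q} \<times> configs q U)"
    using inj_combinator[OF assms, of "\<lambda>_. {1..q}"] by (simp add: configs_def)
  ultimately show ?thesis
    by (simp add: sum.reindex sum.cartesian_product case_prod_unfold o_def)
qed

text \<open>Restricting to edges inside \<open>U\<close> allows vertices to be added one at a time;
  for a graph and \<open>U = V\<close> this is the exponent in \<open>potts_weight\<close>.\<close>

definition mono_count :: "'a set set \<Rightarrow> 'a set \<Rightarrow> ('a \<Rightarrow> nat) \<Rightarrow> nat" where
  "mono_count E U \<pi> = card {e \<in> mono_edges E \<pi>. e \<subseteq> U}"

lemma mono_count_cong:
  assumes "\<And>u. u \<in> U \<Longrightarrow> \<pi> u = \<pi>' u"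
  shows "mono_count E U \<pi> = mono_count E U \<pi>'"
proof -
  have "{e \<in> mono_edges E \<pi>. e \<subseteq> U} \<subseteq> {e \<in> mono_edges E \<pi>'. e \<subseteq> U}"
    if "\<And>u. u \<in> U \<Longrightarrow> \<pi> u = \<pi>' u" for \<pi> \<pi>' :: "'a \<Rightarrow> nat"
  proof
    fix e assume e: "e \<in> {e \<in> mono_edges E \<pi>. e \<subseteq> U}"
    then obtain a b where "e = {a, b}" "a \<noteq> b" "\<pi> a = \<pi> b" by (auto simp: mono_edges_def)
    moreover have "a \<in> U" "b \<in> U" using e calculation by auto
    moreover have "\<pi>' a = \<pi>' b" using that[of a] that[of b] calculation by simp
    ultimately show "e \<in> {e \<in> mono_edges E \<pi>'. e \<subseteq> U}"
      using e unfolding mono_edges_def by blast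
  qed
  from this[of \<pi> \<pi>'] this[of \<pi>' \<pi>]
  have "{e \<in> mono_edges E \<pi>. e \<subseteq> U} = {e \<in> mono_edges E \<pi>'. e \<subseteq> U}"
    using assms by auto
  then show ?thesis by (simp add: mono_count_def)
qed

lemma mono_count_insert:
  assumes "finite U" "u \<notin> U"
  shows "mono_count E (insert u U) \<pi> = mono_count E U \<pi> + card {w \<in> U. adj E u w \<and> \<pi> w = \<pi> u}"
proof -
  let ?B = "{w \<in> U. adj E u w \<and> \<pi> w = \<pi> u}"
  have "{e \<in> mono_edges E \<pi>. e \<subseteq> insert u U} = {e \<in> mono_edges E \<pi>. e \<subseteq> U} \<union> (\<lambda>w. {u, w}) ` ?B"
  proof (intro equalityI subsetI)
    fix e assume e: "e \<in> {e \<in> mono_edges E \<pi>. e \<subseteq> insert u U}"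
    then obtain a b where ab: "e = {a, b}" "a \<noteq> b" "\<pi> a = \<pi> b" "e \<in> E" by (auto simp: mono_edges_def)
    show "e \<in> {e \<in> mono_edges E \<pi>. e \<subseteq> U} \<union> (\<lambda>w. {u, w}) ` ?B"
    proof (cases "u \<in> e")
      case True
      then have "a = u \<or> b = u" using ab by auto
      then obtain w where "e = {u, w}" "u \<noteq> w" "\<pi> u = \<pi> w"
        using ab that[of b] that[of a] by (auto simp: insert_commute)
      then show ?thesis using e ab by (auto simp: adj_def)
    qed (use e in auto)
  qed (use assms in \<open>auto simp: mono_edges_def adj_def\<close>)
  moreover have "card ({e \<in> mono_edges E \<pi>. e \<subseteq> U} \<union> (\<lambda>w. {u, w}) ` ?B)
      = card {e \<in> mono_edges E \<pi>. e \<subseteq> U} + card ((\<lambda>w. {u, w}) ` ?B)"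
    using assms by (intro card_Un_disjoint) auto
  moreover have "card ((\<lambda>w. {u, w}) ` ?B) = card ?B"
    by (intro card_image) (auto simp: inj_on_def doubleton_eq_iff)
  ultimately show ?thesis by (simp add: mono_count_def)
qed

text \<open>With \<open>L\<close> pinned and \<open>U\<close> free, the first term is a constant,
  the second is the energy of the free part, and the third says how the free vertices see the pinned
  colours.\<close>

lemma mono_count_Un:
  assumes "finite U" "finite L" "U \<inter> L = {}"
  shows "mono_count E (U \<union> L) \<pi> =
    mono_count E L \<pi> + (mono_count E U \<pi> + (\<Sum>u\<in>U. card {s \<in> L. adj E u s \<and> \<pi> s = \<pi> u}))"
  using assms(2,3)
proof (induction L rule: finite_induct)
  case empty then show ?case by (simp add: mono_count_def mono_edges_def)
next
  case (insert s L)
  have "{w \<in> U \<union> L. adj E s w \<and> \<pi> w = \<pi> s} = {w \<in> U. adj E s w \<and> \<pi> w = \<pi> s} \<union> {w \<in> L. adj E s w \<and> \<pi> w = \<pi> s}"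
    by auto
  then have 1: "card {w \<in> U \<union> L. adj E s w \<and> \<pi> w = \<pi> s}
      = card {w \<in> U. adj E s w \<and> \<pi> w = \<pi> s} + card {w \<in> L. adj E s w \<and> \<pi> w = \<pi> s}"
    using insert assms by (simp only:) (intro card_Un_disjoint, auto)
  \<comment> \<open>The crossing edges at \<open>s\<close> are counted from the side of
    \<open>U\<close>, so that they merge into the sum over \<open>U\<close>.\<close>
  have 2: "card {w \<in> U. adj E s w \<and> \<pi> w = \<pi> s} = (\<Sum>u\<in>U. if adj E u s \<and> \<pi> s = \<pi> u then 1 else 0)"
    using assms(1) by (simp add: sum.If_cases Int_def adj_sym[of E s] eq_commute[of "\<pi> s"])
  have 3: "card {s' \<in> insert s L. adj E u s' \<and> \<pi> s' = \<pi> u}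
     = card {s' \<in> L. adj E u s' \<and> \<pi> s' = \<pi> u} + (if adj E u s \<and> \<pi> s = \<pi> u then 1 else 0)" for u
  proof -
    have "{s' \<in> insert s L. adj E u s' \<and> \<pi> s' = \<pi> u}
      = (if adj E u s \<and> \<pi> s = \<pi> u then insert s else id) {s' \<in> L. adj E u s' \<and> \<pi> s' = \<pi> u}" by auto
    then show ?thesis using insert by auto
  qed
  have "mono_count E (U \<union> insert s L) \<pi> = mono_count E (U \<union> L) \<pi> + card {w \<in> U \<union> L. adj E s w \<and> \<pi> w = \<pi> s}"
    using insert assms(1) mono_count_insert[of "U \<union> L" s E \<pi>] by simp
  then show ?case
    using insert.IH insert.prems insert.hyps mono_count_insert[of L s E \<pi>]
    by (simp only: 1 2 3 sum.distrib) auto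
qed


lemma card_adj_le_deg:
  assumes "graph V E"
  shows "card {w \<in> V. adj E u w} \<le> deg E u"
proof -
  have "E \<subseteq> Pow V" using assms by (auto simp: graph_def)
  then have "finite E" using assms by (auto simp: graph_def intro: finite_subset)
  moreover have "inj_on (\<lambda>w. {u, w}) {w \<in> V. adj E u w}"
    by (auto simp: inj_on_def doubleton_eq_iff)
  ultimately show ?thesis
    unfolding deg_def by (intro card_inj_on_le[of "\<lambda>w. {u, w}"]) (auto simp: adj_def)
qed

lemma sum_card_fibres_le:
  assumes "finite A"
  shows "(\<Sum>y\<in>{1..q::nat}. card {s \<in> A. P s \<and> f s = y}) \<le> card {s \<in> A. P s}"
proof -
  have "(\<Sum>y\<in>{1..q}. card {s \<in> A. P s \<and> f s = y}) = card (\<Union>y\<in>{1..q}. {s \<in> A. P s \<and> f s = y})"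
    using assms by (intro card_UN_disjoint[symmetric]) auto
  also have "\<dots> \<le> card {s \<in> A. P s}" using assms by (intro card_mono) auto
  finally show ?thesis .
qed

section \<open>Self-avoiding walks to a fixed end, split at their first step\<close>

text \<open>The source \<open>w\<close> is left out of the list: it may be a pinned vertex outside
  \<open>U\<close>, and only the vertices entered afterwards are to carry weight.\<close>

definition saw_to :: "'a set set \<Rightarrow> 'a set \<Rightarrow> 'a \<Rightarrow> 'a \<Rightarrow> 'a list set" where
  "saw_to E U w v =
     {xs. distinct (w # xs) \<and> set xs \<subseteq> U \<and> successively (adj E) (w # xs) \<and> last (w # xs) = v}"

lemma finite_saw_to:
  assumes "finite U"
  shows "finite (saw_to E U w v)"
  by (rule finite_subset[OF _ finite_subset_distinct[OF assms]]) (auto simp: saw_to_def)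

lemma saw_to_self:
  assumes "v \<notin> U"
  shows "saw_to E U v v = {[]}"
proof -
  have "xs = []" if "xs \<in> saw_to E U v v" for xs
    using that last_in_set[of xs] by (cases "xs = []") (auto simp: saw_to_def)
  moreover have "[] \<in> saw_to E U v v" by (simp add: saw_to_def)
  ultimately show ?thesis by blast
qed

text \<open>Self-avoidance is expressed by deleting each visited vertex from \<open>U\<close>, which
  matches pinning it in the probabilistic recursion.\<close>

lemma saw_to_step:
  assumes "w \<noteq> v" "w \<notin> U"
  shows "saw_to E U w v = (\<Union>u\<in>{u \<in> U. adj E w u}. (#) u ` saw_to E (U - {u}) u v)"
proof (intro equalityI subsetI)
  fix xs assume xs: "xs \<in> saw_to E U w v"
  then obtain u ys where "xs = u # ys" using assms by (cases xs) (auto simp: saw_to_def)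
  moreover from this have "u \<in> {u \<in> U. adj E w u}" "ys \<in> saw_to E (U - {u}) u v"
    using xs by (auto simp: saw_to_def)
  ultimately show "xs \<in> (\<Union>u\<in>{u \<in> U. adj E w u}. (#) u ` saw_to E (U - {u}) u v)" by blast
next
  fix xs assume "xs \<in> (\<Union>u\<in>{u \<in> U. adj E w u}. (#) u ` saw_to E (U - {u}) u v)"
  then show "xs \<in> saw_to E U w v" using assms by (auto simp: saw_to_def)
qed

section \<open>Systems with coloured half-edges and conditioning on one vertex\<close>

text \<open>The weight \<open>\<delta>\<close> is not tied to the activity, so that one
  \<open>\<delta>\<close> can serve a whole range of activities. The last assumption is the
  condition on \<open>t\<close> in \<open>reweighted_mean_diff\<close> with
  \<open>t = \<delta> d\<close> and \<open>Q = q - (1 - \<beta>) d\<close>.\<close>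

locale potts =
  fixes q :: nat and \<beta> :: real and E :: "'a set set" and \<delta> :: "nat \<Rightarrow> real"
  assumes q: "q \<ge> 1" and \<beta>: "0 < \<beta>" "\<beta> < 1"
    and \<delta>_nonneg: "0 \<le> \<delta> d"
    and \<delta>_dominates: "\<delta> d < 1 \<Longrightarrow> 1 - \<beta> \<le> \<delta> d * (real q - (1 - \<beta>) * real d)"
begin

text \<open>A pinned vertex acts on its free neighbours only through its colour, so an instance is encoded
  as the set \<open>U\<close> of free vertices together with \<open>m u y\<close>, the number of pinned neighbours of \<open>u\<close>
  with colour \<open>y\<close>. Allowing arbitrary \<open>m\<close> amounts to colouring the half-edges at \<open>u\<close> independently.\<close>

definition wt :: "'a set \<Rightarrow> ('a \<Rightarrow> nat \<Rightarrow> nat) \<Rightarrow> ('a \<Rightarrow> nat) \<Rightarrow> real" where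
  "wt U m \<pi> = \<beta> ^ (mono_count E U \<pi> + (\<Sum>u\<in>U. m u (\<pi> u)))"

definition Z :: "'a set \<Rightarrow> ('a \<Rightarrow> nat \<Rightarrow> nat) \<Rightarrow> real" where
  "Z U m = (\<Sum>\<pi>\<in>configs q U. wt U m \<pi>)"

definition num :: "'a set \<Rightarrow> ('a \<Rightarrow> nat \<Rightarrow> nat) \<Rightarrow> 'a \<Rightarrow> nat \<Rightarrow> real" where
  "num U m v x = (\<Sum>\<pi>\<in>configs q U. if \<pi> v = x then wt U m \<pi> else 0)"

definition prb :: "'a set \<Rightarrow> ('a \<Rightarrow> nat \<Rightarrow> nat) \<Rightarrow> 'a \<Rightarrow> nat \<Rightarrow> real" where
  "prb U m v x = num U m v x / Z U m"

text \<open>The update of the pinned-neighbour counts when \<open>u\<close> is pinned to colour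
  \<open>a\<close>; removing \<open>u\<close> from the free set is done separately.\<close>

definition push :: "('a \<Rightarrow> nat \<Rightarrow> nat) \<Rightarrow> 'a \<Rightarrow> nat \<Rightarrow> 'a \<Rightarrow> nat \<Rightarrow> nat" where
  "push m u a = (\<lambda>w y. m w y + (if adj E u w \<and> y = a then 1 else 0))"

text \<open>For \<open>w \<noteq> v\<close> the end \<open>v\<close> of a walk contributes its
  factor and the source \<open>w\<close> does not.\<close>

definition infl :: "'a set \<Rightarrow> 'a \<Rightarrow> 'a \<Rightarrow> real" where
  "infl U w v = (\<Sum>xs\<in>saw_to E U w v. prod_list (map (\<lambda>u. \<delta> (deg E u)) xs))"

lemma wt_pos: "wt U m \<pi> > 0"
  using \<beta> by (simp add: wt_def)

lemma Z_pos: "finite U \<Longrightarrow> Z U m > 0"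
  unfolding Z_def using q
  by (intro sum_pos wt_pos finite_configs) (auto simp: configs_def PiE_eq_empty_iff)

lemma wt_cong:
  assumes "\<And>u. u \<in> U \<Longrightarrow> \<pi> u = \<pi>' u" "\<And>u. u \<in> U \<Longrightarrow> m u = m' u"
  shows "wt U m \<pi> = wt U m' \<pi>'"
  using mono_count_cong[of U \<pi> \<pi>' E] assms by (simp add: wt_def)

lemma Z_cong: "(\<And>u. u \<in> U \<Longrightarrow> m u = m' u) \<Longrightarrow> Z U m = Z U m'"
  unfolding Z_def by (intro sum.cong wt_cong) auto

lemma num_cong: "(\<And>u. u \<in> U \<Longrightarrow> m u = m' u) \<Longrightarrow> num U m v x = num U m' v x"
  unfolding num_def by (intro sum.cong if_cong wt_cong) auto

lemma prb_cong: "(\<And>u. u \<in> U \<Longrightarrow> m u = m' u) \<Longrightarrow> prb U m v x = prb U m' v x"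
  unfolding prb_def using Z_cong[of U m m'] num_cong[of U m m'] by simp

lemma wt_push:
  assumes "finite U"
  shows "wt U (push m u a) \<pi> = wt U m \<pi> * \<beta> ^ card {w \<in> U. adj E u w \<and> \<pi> w = a}"
proof -
  have "(\<Sum>w\<in>U. if adj E u w \<and> \<pi> w = a then 1 else 0) = card {w \<in> U. adj E u w \<and> \<pi> w = a}"
    using assms by (simp add: sum.If_cases Int_def)
  then show ?thesis by (simp add: wt_def push_def sum.distrib power_add)
qed

lemma wt_insert:
  assumes "finite U" "u \<notin> U"
  shows "wt (insert u U) m (\<pi>(u := a)) = \<beta> ^ m u a * wt U (push m u a) \<pi>"
proof -
  have "wt (insert u U) m (\<pi>(u := a)) = \<beta> ^ m u a * wt U (push m u a) (\<pi>(u := a))"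
    using assms by (simp add: wt_push) (simp add: wt_def mono_count_insert power_add mult_ac)
  also have "wt U (push m u a) (\<pi>(u := a)) = wt U (push m u a) \<pi>"
    using assms by (intro wt_cong) auto
  finally show ?thesis .
qed

lemma Z_insert:
  assumes "finite U" "u \<notin> U"
  shows "Z (insert u U) m = (\<Sum>a\<in>{1..q}. \<beta> ^ m u a * Z U (push m u a))"
  using assms unfolding Z_def by (simp add: sum_configs_insert wt_insert sum_distrib_left)

text \<open>Law of total probability over the colour of \<open>u\<close>. Keeping the weights
  unnormalised turns the marginal into a weighted mean whose denominator is
  \<open>Z_insert\<close>.\<close>

lemma num_insert:
  assumes "finite U" "u \<notin> U"
  shows "num (insert u U) m v x = (\<Sum>a\<in>{1..q}. \<beta> ^ m u a * Z U (push m u a) *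
           (if u = v then (if a = x then 1 else 0) else prb U (push m u a) v x))"
proof -
  have "num (insert u U) m v x = (\<Sum>a\<in>{1..q}. \<Sum>\<pi>\<in>configs q U.
     if (\<pi>(u := a)) v = x then \<beta> ^ m u a * wt U (push m u a) \<pi> else 0)"
    unfolding num_def sum_configs_insert[OF assms(2)] wt_insert[OF assms] by (rule refl)
  also have "\<dots> = (\<Sum>a\<in>{1..q}. \<beta> ^ m u a * Z U (push m u a) *
           (if u = v then (if a = x then 1 else 0) else prb U (push m u a) v x))"
  proof (intro sum.cong refl)
    fix a assume "a \<in> {1..q}"
    show "(\<Sum>\<pi>\<in>configs q U. if (\<pi>(u := a)) v = x then \<beta> ^ m u a * wt U (push m u a) \<pi> else 0)
      = \<beta> ^ m u a * Z U (push m u a) * (if u = v then (if a = x then 1 else 0) else prb U (push m u a) v x)"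
    proof (cases "u = v")
      case True
      then show ?thesis by (simp add: Z_def sum_distrib_left)
    next
      case False
      have "(\<Sum>\<pi>\<in>configs q U. if \<pi> v = x then \<beta> ^ m u a * wt U (push m u a) \<pi> else 0)
         = \<beta> ^ m u a * num U (push m u a) v x"
        unfolding num_def sum_distrib_left by (intro sum.cong) auto
      then show ?thesis using False Z_pos[OF assms(1), of "push m u a"] by (simp add: prb_def)
    qed
  qed
  finally show ?thesis .
qed

lemma infl_self: "v \<notin> U \<Longrightarrow> infl U v v = 1"
  by (simp add: infl_def saw_to_self)

lemma infl_step:
  assumes "finite U" "w \<noteq> v" "w \<notin> U"
  shows "infl U w v = (\<Sum>u\<in>{u \<in> U. adj E w u}. \<delta> (deg E u) * infl (U - {u}) u v)"
proof -
  have "infl U w v = (\<Sum>u\<in>{u \<in> U. adj E w u}. \<Sum>xs\<in>(#) u ` saw_to E (U - {u}) u v.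
      prod_list (map (\<lambda>u. \<delta> (deg E u)) xs))"
    unfolding infl_def saw_to_step[OF assms(2,3)] using assms(1)
    by (intro sum.UNION_disjoint) (auto intro!: finite_saw_to)
  also have "\<dots> = (\<Sum>u\<in>{u \<in> U. adj E w u}. \<delta> (deg E u) * infl (U - {u}) u v)"
    by (intro sum.cong refl) (simp add: sum.reindex infl_def sum_distrib_left)
  finally show ?thesis .
qed

section \<open>Influence of one half-edge and of one pinned vertex\<close>

text \<open>For a fixed colouring of \<open>U\<close>, colour \<open>b\<close> at \<open>u\<close>
  costs \<open>\<beta> ^ e \<pi> b\<close>, where the exponents sum to at most \<open>d - 1\<close>;
  the \<open>1\<close> is reserved for the half-edge to be recoloured. Bernoulli's inequality bounds
  the sum of these powers below by \<open>q - (1 - \<beta>)(d - 1)\<close>, and summing over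
  colourings gives the claim.\<close>

lemma weight_le_total:
  assumes "finite U" and d: "(\<Sum>y\<in>{1..q}. n y) + card {w \<in> U. adj E u w} + 1 \<le> d"
    and a: "a \<in> {1..q}"
  shows "\<beta> ^ n a * Z U (push m u a) * (real q - (1 - \<beta>) * real d + (1 - \<beta>))
       \<le> (\<Sum>b\<in>{1..q}. \<beta> ^ n b * Z U (push m u b))"
proof -
  define e where "e \<equiv> \<lambda>\<pi> b. n b + card {w \<in> U. adj E u w \<and> \<pi> w = b}"
  have Z: "\<beta> ^ n b * Z U (push m u b) = (\<Sum>\<pi>\<in>configs q U. wt U m \<pi> * \<beta> ^ e \<pi> b)" for b
    using assms(1) by (simp add: Z_def wt_push sum_distrib_left e_def power_add mult_ac)
  let ?X = "real q - (1 - \<beta>) * real d + (1 - \<beta>)"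
  have X: "\<beta> ^ e \<pi> a * ?X \<le> (\<Sum>b\<in>{1..q}. \<beta> ^ e \<pi> b)" for \<pi>
  proof -
    have "(\<Sum>b\<in>{1..q}. e \<pi> b) + 1 \<le> d"
      using d sum_card_fibres_le[OF assms(1), of "adj E u" \<pi> q] by (simp add: e_def sum.distrib)
    then have "real (\<Sum>b\<in>{1..q}. e \<pi> b) \<le> real d - 1" by linarith
    then have "(1 - \<beta>) * real (\<Sum>b\<in>{1..q}. e \<pi> b) \<le> (1 - \<beta>) * (real d - 1)"
      using \<beta> by (intro mult_left_mono) auto
    moreover have "(\<Sum>b\<in>{1..q}. 1 - (1 - \<beta>) * real (e \<pi> b)) = real q - (1 - \<beta>) * real (\<Sum>b\<in>{1..q}. e \<pi> b)"
      by (simp add: sum_subtractf flip: sum_distrib_left)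
    ultimately have "?X \<le> (\<Sum>b\<in>{1..q}. 1 - (1 - \<beta>) * real (e \<pi> b))"
      by (simp add: algebra_simps)
    also have "\<dots> \<le> (\<Sum>b\<in>{1..q}. \<beta> ^ e \<pi> b)"
      using Bernoulli_inequality[of "\<beta> - 1"] \<beta> by (intro sum_mono) (simp add: algebra_simps)
    finally have *: "?X \<le> (\<Sum>b\<in>{1..q}. \<beta> ^ e \<pi> b)" .
    have p: "0 \<le> \<beta> ^ e \<pi> a" "\<beta> ^ e \<pi> a \<le> 1" using \<beta> by (auto simp: power_le_one)
    have "0 \<le> (\<Sum>b\<in>{1..q}. \<beta> ^ e \<pi> b)" using \<beta> by (intro sum_nonneg) auto
    \<comment> \<open>The maximum with 0 covers large degrees, where \<open>?X\<close> may be
      negative.\<close>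
    moreover have "\<beta> ^ e \<pi> a * ?X \<le> max 0 ?X"
      using p mult_left_le_one_le[of ?X "\<beta> ^ e \<pi> a"] mult_nonneg_nonpos[of "\<beta> ^ e \<pi> a" ?X] by linarith
    ultimately show ?thesis using * by linarith
  qed
  have "(\<Sum>\<pi>\<in>configs q U. wt U m \<pi> * \<beta> ^ e \<pi> a) * ?X = (\<Sum>\<pi>\<in>configs q U. wt U m \<pi> * (\<beta> ^ e \<pi> a * ?X))"
    unfolding sum_distrib_right by (simp only: mult.assoc)
  also have "\<dots> \<le> (\<Sum>\<pi>\<in>configs q U. wt U m \<pi> * (\<Sum>b\<in>{1..q}. \<beta> ^ e \<pi> b))"
    using wt_pos by (intro sum_mono mult_left_mono X) (auto intro: less_imp_le)
  also have "\<dots> = (\<Sum>b\<in>{1..q}. \<Sum>\<pi>\<in>configs q U. wt U m \<pi> * \<beta> ^ e \<pi> b)"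
    by (subst sum.swap) (simp add: sum_distrib_left)
  finally show ?thesis by (simp only: Z)
qed

text \<open>The two systems differ in a single half-edge at \<open>u\<close>, coloured
  \<open>c\<close> or \<open>c'\<close>, and \<open>n\<close> counts the other coloured half-edges
  there. Given the colour of \<open>u\<close> they agree, so both marginals are means of the same
  \<open>f\<close> with a factor \<open>\<beta>\<close> at \<open>c\<close> or at
  \<open>c'\<close>.\<close>

lemma half_edge_influence:
  assumes fin: "finite U" and u: "u \<notin> U" and c: "c \<in> {1..q}" "c' \<in> {1..q}"
    and m: "\<And>w. w \<in> U \<Longrightarrow> m w = m' w"
    and mu: "\<And>y. m u y = n y + (if y = c then 1 else 0)" "\<And>y. m' u y = n y + (if y = c' then 1 else 0)"
    and d: "(\<Sum>y\<in>{1..q}. n y) + card {w \<in> U. adj E u w} + 1 \<le> deg E u"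
    and IH: "\<And>a b. u \<noteq> v \<Longrightarrow> a \<in> {1..q} \<Longrightarrow> b \<in> {1..q} \<Longrightarrow>
        \<bar>prb U (push m u a) v x - prb U (push m u b) v x\<bar> \<le> infl U u v"
  shows "\<bar>prb (insert u U) m v x - prb (insert u U) m' v x\<bar> \<le> \<delta> (deg E u) * infl U u v"
proof -
  define r where "r \<equiv> \<lambda>a. \<beta> ^ n a * Z U (push m u a)"
  \<comment> \<open>For \<open>u = v\<close> this is an indicator, whose oscillation is at most 1,
    the weight of the empty walk.\<close>
  define f where "f \<equiv> \<lambda>a. if u = v then (if a = x then 1 else 0) else prb U (push m u a) v x"
  have eq: "Z U (push m' u a) = Z U (push m u a)" "prb U (push m' u a) v x = prb U (push m u a) v x" for a
    by (intro Z_cong prb_cong; simp add: push_def m)+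
  have 1: "prb (insert u U) m v x =
      (\<Sum>a\<in>{1..q}. r a * (if a = c then \<beta> else 1) * f a) / (\<Sum>a\<in>{1..q}. r a * (if a = c then \<beta> else 1))"
    unfolding prb_def num_insert[OF fin u] Z_insert[OF fin u]
    by (intro arg_cong2[where f = "(/)"] sum.cong) (auto simp: r_def f_def mu prb_def)
  have 2: "prb (insert u U) m' v x =
      (\<Sum>a\<in>{1..q}. r a * (if a = c' then \<beta> else 1) * f a) / (\<Sum>a\<in>{1..q}. r a * (if a = c' then \<beta> else 1))"
    unfolding prb_def[of "insert u U"] num_insert[OF fin u] Z_insert[OF fin u]
    by (intro arg_cong2[where f = "(/)"] sum.cong) (auto simp: r_def f_def mu eq)
  show ?thesis unfolding 1 2
  proof (rule reweighted_mean_diff[where Q = "real q - (1 - \<beta>) * real (deg E u)"])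
    show "r a > 0" for a using \<beta> Z_pos[OF fin] by (simp add: r_def)
    show "\<bar>f a - f b\<bar> \<le> infl U u v" if "a \<in> {1..q}" "b \<in> {1..q}" for a b
      using IH[OF _ that] infl_self[OF u] by (auto simp: f_def)
    show "r a * (real q - (1 - \<beta>) * real (deg E u) + (1 - \<beta>)) \<le> sum r {1..q}" if "a \<in> {1..q}" for a
      unfolding r_def by (rule weight_le_total[OF fin d that])
  qed (use c \<beta> \<delta>_nonneg \<delta>_dominates in auto)
qed

text \<open>Induction on the free set. The counts \<open>k\<close> are arbitrary because the hybrids
  give the half-edges leaving \<open>w\<close> different colours, which no single colour of
  \<open>w\<close> realises. The degree bound counts coloured half-edges, free neighbours and the
  edge to \<open>w\<close>, and it persists when a free vertex becomes the new source.\<close>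

lemma pin_influence:
  assumes "finite U" "w \<notin> U" "v \<in> U" "a \<in> {1..q}" "b \<in> {1..q}"
    and "\<And>u. u \<in> U \<Longrightarrow>
      (\<Sum>y\<in>{1..q}. k u y) + card {z \<in> U. adj E u z} + (if adj E w u then 1 else 0) \<le> deg E u"
  shows "\<bar>prb U (push k w a) v x - prb U (push k w b) v x\<bar> \<le> infl U w v"
  using assms
proof (induction U arbitrary: w k a b rule: finite_psubset_induct)
  case (psubset U)
  define N where "N = {u \<in> U. adj E w u}"
  \<comment> \<open>half-edges from \<open>w\<close> into \<open>S\<close> already recoloured from \<open>a\<close> to \<open>b\<close>\<close>
  define hyb where "hyb \<equiv> \<lambda>S u y. k u y + (if adj E w u \<and> y = (if u \<in> S then b else a) then 1 else 0)"
  have sum_hyb: "(\<Sum>y\<in>{1..q}. hyb S u y) = (\<Sum>y\<in>{1..q}. k u y) + (if adj E w u then 1 else 0)" for S u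
    using psubset.prems(3,4) by (simp add: hyb_def sum.distrib)
  have step: "\<bar>prb U (hyb S) v x - prb U (hyb (insert u S)) v x\<bar> \<le> \<delta> (deg E u) * infl (U - {u}) u v"
    if "u \<in> N" "u \<notin> S" for u S
  proof -
    have U: "insert u (U - {u}) = U" "u \<notin> U - {u}" "finite (U - {u})" and wu: "adj E w u" "u \<in> U"
      using that psubset.hyps by (auto simp: N_def)
    have "\<bar>prb (insert u (U - {u})) (hyb S) v x - prb (insert u (U - {u})) (hyb (insert u S)) v x\<bar>
      \<le> \<delta> (deg E u) * infl (U - {u}) u v"
    proof (rule half_edge_influence[where n = "k u" and c = a and c' = b])
      have "card {z \<in> U - {u}. adj E u z} \<le> card {z \<in> U. adj E u z}"
        using psubset.hyps by (intro card_mono) auto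
      then show "(\<Sum>y\<in>{1..q}. k u y) + card {z \<in> U - {u}. adj E u z} + 1 \<le> deg E u"
        using psubset.prems(5)[of u] wu by simp
    next
      fix a' b' assume uv: "u \<noteq> v" and ab: "a' \<in> {1..q}" "b' \<in> {1..q}"
      show "\<bar>prb (U - {u}) (push (hyb S) u a') v x - prb (U - {u}) (push (hyb S) u b') v x\<bar> \<le> infl (U - {u}) u v"
      proof (rule psubset.IH)
        fix z assume z: "z \<in> U - {u}"
        \<comment> \<open>For \<open>z\<close>, the edge to \<open>w\<close> is now a coloured
          half-edge and \<open>u\<close> changes from a free neighbour to the source; the total is
          unchanged.\<close>
        have "{y \<in> U. adj E z y} = (if adj E u z then insert u else id) {y \<in> U - {u}. adj E z y}"
          using wu by (auto simp: adj_sym[of E u])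
        then have "card {y \<in> U. adj E z y} = card {y \<in> U - {u}. adj E z y} + (if adj E u z then 1 else 0)"
          using psubset.hyps by auto
        then show "(\<Sum>y\<in>{1..q}. hyb S z y) + card {y \<in> U - {u}. adj E z y} + (if adj E u z then 1 else 0) \<le> deg E z"
          using psubset.prems(5)[OF DiffD1[OF z]] sum_hyb[of S z] by linarith
      qed (use wu psubset.prems(3) uv ab psubset.prems(2) in auto)
    qed (use U(2,3) wu that psubset.prems(3,4) in \<open>auto simp: hyb_def fun_eq_iff\<close>)
    then show ?thesis using U(1) by simp
  qed
  have "finite N" using psubset.hyps by (simp add: N_def)
  \<comment> \<open>Between \<open>S = {}\<close> and \<open>S = N\<close> the hybrids lead from
    \<open>w\<close> coloured \<open>a\<close> to \<open>w\<close> coloured \<open>b\<close>; the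
    summands are those of \<open>infl_step\<close>.\<close>
  have tele: "\<bar>prb U (hyb {}) v x - prb U (hyb S) v x\<bar> \<le> (\<Sum>u\<in>S. \<delta> (deg E u) * infl (U - {u}) u v)"
    if "finite S" "S \<subseteq> N" for S
    using that
  proof (induction S rule: finite_induct)
    case (insert u S)
    then show ?case using step[of u S] by simp
  qed simp
  have "prb U (push k w a) v x = prb U (hyb {}) v x"
    by (rule prb_cong) (simp add: push_def hyb_def)
  moreover have "prb U (push k w b) v x = prb U (hyb N) v x"
    by (rule prb_cong) (auto simp: push_def hyb_def N_def fun_eq_iff)
  moreover have "w \<noteq> v" using psubset.prems by auto
  ultimately show ?case
    using tele[OF \<open>finite N\<close> order_refl] infl_step[OF psubset.hyps(1) _ psubset.prems(1), of v]
    by (simp add: N_def)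
qed

section \<open>Translation from Potts instances with a boundary condition\<close>

definition pins :: "'a set \<Rightarrow> ('a \<Rightarrow> nat) \<Rightarrow> 'a \<Rightarrow> nat \<Rightarrow> nat" where
  "pins \<Lambda> \<sigma> u y = card {s \<in> \<Lambda>. adj E u s \<and> \<sigma> s = y}"

text \<open>The predicate \<open>P\<close> lets one computation serve both the numerator of a
  marginal and the partition function; the common factor from edges inside \<open>\<Lambda>\<close>
  then cancels.\<close>

lemma sum_potts_weight:
  assumes G: "graph V E" and L: "\<Lambda> \<subseteq> V" "\<forall>u\<in>\<Lambda>. \<sigma> u \<in> {1..q}" and v: "v \<in> V - \<Lambda>"
  shows "(\<Sum>\<pi>\<in>configs q V. if P (\<pi> v) then potts_weight \<beta> E \<Lambda> \<sigma> \<pi> else 0) =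
    \<beta> ^ mono_count E \<Lambda> \<sigma> * (\<Sum>\<pi>\<in>configs q (V - \<Lambda>). if P (\<pi> v) then wt (V - \<Lambda>) (pins \<Lambda> \<sigma>) \<pi> else 0)"
proof -
  define U where "U = V - \<Lambda>"
  have fin: "finite V" "finite U" "finite \<Lambda>" and V: "V = U \<union> \<Lambda>" "U \<inter> \<Lambda> = {}"
    using G L by (auto simp: graph_def U_def intro: finite_subset)
  define ext where "ext \<equiv> \<lambda>\<pi> u. if u \<in> \<Lambda> then \<sigma> u else \<pi> u"
  have w: "potts_weight \<beta> E \<Lambda> \<sigma> (ext \<pi>) = \<beta> ^ mono_count E \<Lambda> \<sigma> * wt U (pins \<Lambda> \<sigma>) \<pi>" for \<pi>
  proof -
    have "e \<subseteq> V" if "e \<in> E" for e using G that by (auto simp: graph_def)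
    then have "{e \<in> mono_edges E (ext \<pi>). e \<subseteq> V} = mono_edges E (ext \<pi>)"
      by (auto simp: mono_edges_def)
    then have "card (mono_edges E (ext \<pi>)) = mono_count E V (ext \<pi>)" by (simp add: mono_count_def)
    also have "\<dots> = mono_count E \<Lambda> (ext \<pi>) + (mono_count E U (ext \<pi>) +
        (\<Sum>u\<in>U. card {s \<in> \<Lambda>. adj E u s \<and> ext \<pi> s = ext \<pi> u}))"
      unfolding V(1) using mono_count_Un[OF fin(2,3) V(2)] .
    also have "mono_count E \<Lambda> (ext \<pi>) = mono_count E \<Lambda> \<sigma>" by (rule mono_count_cong) (simp add: ext_def)
    also have "mono_count E U (ext \<pi>) = mono_count E U \<pi>"
      by (rule mono_count_cong) (auto simp: ext_def U_def)
    also have "(\<Sum>u\<in>U. card {s \<in> \<Lambda>. adj E u s \<and> ext \<pi> s = ext \<pi> u}) = (\<Sum>u\<in>U. pins \<Lambda> \<sigma> u (\<pi> u))"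
      unfolding pins_def by (intro sum.cong refl arg_cong[where f = card]) (auto simp: ext_def U_def)
    finally show ?thesis by (simp add: potts_weight_def wt_def power_add ext_def)
  qed
  have "(\<Sum>\<pi>\<in>configs q V. if P (\<pi> v) then potts_weight \<beta> E \<Lambda> \<sigma> \<pi> else 0)
     = (\<Sum>\<pi>\<in>{\<pi> \<in> configs q V. \<forall>u\<in>\<Lambda>. \<pi> u = \<sigma> u}. if P (\<pi> v) then potts_weight \<beta> E \<Lambda> \<sigma> \<pi> else 0)"
    using fin(1) by (intro sum.mono_neutral_right finite_configs) (auto simp: potts_weight_def)
  also have "\<dots> = (\<Sum>\<pi>\<in>configs q U. if P (ext \<pi> v) then potts_weight \<beta> E \<Lambda> \<sigma> (ext \<pi>) else 0)"
  \<comment> \<open>Configurations agreeing with \<open>\<sigma>\<close> on \<open>\<Lambda>\<close>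
    correspond to configurations of the free vertices.\<close>
  proof (rule sum.reindex_bij_witness[where i = ext and j = "\<lambda>\<pi>. restrict \<pi> U"])
    fix \<pi> assume p: "\<pi> \<in> {\<pi> \<in> configs q V. \<forall>u\<in>\<Lambda>. \<pi> u = \<sigma> u}"
    show *: "ext (restrict \<pi> U) = \<pi>"
      using p by (auto simp: ext_def U_def configs_def fun_eq_iff PiE_def extensional_def)
    show "restrict \<pi> U \<in> configs q U" using p by (auto simp: configs_def U_def)
    show "(if P (ext (restrict \<pi> U) v) then potts_weight \<beta> E \<Lambda> \<sigma> (ext (restrict \<pi> U)) else 0)
      = (if P (\<pi> v) then potts_weight \<beta> E \<Lambda> \<sigma> \<pi> else 0)" by (simp add: *)
  next
    fix \<pi> assume p: "\<pi> \<in> configs q U"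
    show "restrict (ext \<pi>) U = \<pi>"
      using p by (auto simp: ext_def U_def configs_def fun_eq_iff PiE_def extensional_def)
    show "ext \<pi> \<in> {\<pi> \<in> configs q V. \<forall>u\<in>\<Lambda>. \<pi> u = \<sigma> u}"
      using p L by (auto simp: ext_def U_def configs_def PiE_def extensional_def Pi_def)
  qed
  also have "\<dots> = \<beta> ^ mono_count E \<Lambda> \<sigma> * (\<Sum>\<pi>\<in>configs q U. if P (\<pi> v) then wt U (pins \<Lambda> \<sigma>) \<pi> else 0)"
    unfolding sum_distrib_left w using v by (intro sum.cong) (auto simp: ext_def)
  finally show ?thesis unfolding U_def .
qed

lemma marginal_eq_prb:
  assumes "graph V E" "\<Lambda> \<subseteq> V" "\<forall>u\<in>\<Lambda>. \<sigma> u \<in> {1..q}" "v \<in> V - \<Lambda>"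
  shows "marginal q \<beta> V E \<Lambda> \<sigma> v x = prb (V - \<Lambda>) (pins \<Lambda> \<sigma>) v x"
proof -
  have "finite (configs q V)" using assms by (auto simp: graph_def intro: finite_configs)
  then have "(\<Sum>\<pi>\<in>{\<pi>\<in>configs q V. \<pi> v = x}. potts_weight \<beta> E \<Lambda> \<sigma> \<pi>)
    = (\<Sum>\<pi>\<in>configs q V. if \<pi> v = x then potts_weight \<beta> E \<Lambda> \<sigma> \<pi> else 0)"
    by (simp add: sum.inter_filter)
  then show ?thesis
    using sum_potts_weight[OF assms, of "\<lambda>y. y = x"] sum_potts_weight[OF assms, of "\<lambda>_. True"] \<beta>
    by (simp add: marginal_def partition_fn_def prb_def num_def Z_def)
qed

text \<open>The boundary condition is changed from \<open>\<sigma>\<close> to \<open>\<tau>\<close>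
  one disagreeing vertex at a time, and each change costs one application of
  \<open>pin_influence\<close>. The intermediate conditions are harmless because the activity is
  positive.\<close>

lemma marginal_diff_le_infl:
  assumes G: "graph V E" and L: "\<Lambda> \<subseteq> V" and \<sigma>: "\<forall>u\<in>\<Lambda>. \<sigma> u \<in> {1..q}" and \<tau>: "\<forall>u\<in>\<Lambda>. \<tau> u \<in> {1..q}"
    and v: "v \<in> V - \<Lambda>"
  shows "\<bar>marginal q \<beta> V E \<Lambda> \<sigma> v x - marginal q \<beta> V E \<Lambda> \<tau> v x\<bar>
     \<le> (\<Sum>w\<in>{u\<in>\<Lambda>. \<sigma> u \<noteq> \<tau> u}. infl (V - \<Lambda>) w v)"
proof -
  define U where "U = V - \<Lambda>"
  define D where "D = {u\<in>\<Lambda>. \<sigma> u \<noteq> \<tau> u}"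
  define mix where "mix \<equiv> \<lambda>S u. if u \<in> S then \<tau> u else \<sigma> u"
  have fin: "finite V" "finite U" "finite \<Lambda>" "finite D"
    using G L by (auto simp: graph_def U_def D_def intro: finite_subset)
  have step: "\<bar>prb U (pins \<Lambda> (mix S)) v x - prb U (pins \<Lambda> (mix (insert w S))) v x\<bar> \<le> infl U w v"
    if w: "w \<in> \<Lambda>" "w \<notin> S" for w S
  proof -
    define k where "k = pins (\<Lambda> - {w}) (mix S)"
    have p: "pins \<Lambda> \<rho> = push k w (\<rho> w)" if "\<And>s. s \<noteq> w \<Longrightarrow> \<rho> s = mix S s" for \<rho>
    proof (intro ext)
      fix u y
      have "{s \<in> \<Lambda>. adj E u s \<and> \<rho> s = y} = (if adj E w u \<and> y = \<rho> w then insert w else id)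
          {s \<in> \<Lambda> - {w}. adj E u s \<and> \<rho> s = y}"
        using w by (auto simp: adj_sym[of E w])
      also have "{s \<in> \<Lambda> - {w}. adj E u s \<and> \<rho> s = y} = {s \<in> \<Lambda> - {w}. adj E u s \<and> mix S s = y}"
        using that by auto
      finally have "{s \<in> \<Lambda>. adj E u s \<and> \<rho> s = y} = (if adj E w u \<and> y = \<rho> w then insert w else id)
          {s \<in> \<Lambda> - {w}. adj E u s \<and> mix S s = y}" .
      then show "pins \<Lambda> \<rho> u y = push k w (\<rho> w) u y"
        using fin by (auto simp: pins_def push_def k_def)
    qed
    have "\<bar>prb U (push k w (\<sigma> w)) v x - prb U (push k w (\<tau> w)) v x\<bar> \<le> infl U w v"
    proof (rule pin_influence)
      fix u assume "u \<in> U"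
      have k: "(\<Sum>y\<in>{1..q}. k u y) \<le> card {s \<in> \<Lambda> - {w}. adj E u s}"
        unfolding k_def pins_def using fin by (intro sum_card_fibres_le) auto
      \<comment> \<open>The neighbours of \<open>u\<close> are the other pinned ones, the free ones
        and possibly \<open>w\<close>; this is the degree bound required by
        \<open>pin_influence\<close>.\<close>
      have "{z \<in> V. adj E u z} = {s \<in> \<Lambda> - {w}. adj E u s} \<union> {z \<in> U. adj E u z} \<union>
          (if adj E w u then {w} else {})"
        using w L by (auto simp: U_def adj_sym[of E w])
      moreover have "card ({s \<in> \<Lambda> - {w}. adj E u s} \<union> {z \<in> U. adj E u z} \<union> (if adj E w u then {w} else {}))
        = card ({s \<in> \<Lambda> - {w}. adj E u s} \<union> {z \<in> U. adj E u z}) + card (if adj E w u then {w} else {})"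
        using fin w by (intro card_Un_disjoint) (auto simp: U_def)
      moreover have "card ({s \<in> \<Lambda> - {w}. adj E u s} \<union> {z \<in> U. adj E u z})
        = card {s \<in> \<Lambda> - {w}. adj E u s} + card {z \<in> U. adj E u z}"
        using fin by (intro card_Un_disjoint) (auto simp: U_def)
      ultimately have "card {z \<in> V. adj E u z} = card {s \<in> \<Lambda> - {w}. adj E u s} + card {z \<in> U. adj E u z} +
          (if adj E w u then 1 else 0)" by simp
      then show "(\<Sum>y\<in>{1..q}. k u y) + card {z \<in> U. adj E u z} + (if adj E w u then 1 else 0) \<le> deg E u"
        using k card_adj_le_deg[OF G, of u] by linarith
    qed (use fin w v \<sigma> \<tau> in \<open>auto simp: U_def\<close>)
    moreover have "pins \<Lambda> (mix S) = push k w (\<sigma> w)" using p[of "mix S"] w by (simp add: mix_def)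
    moreover have "pins \<Lambda> (mix (insert w S)) = push k w (\<tau> w)"
      using p[of "mix (insert w S)"] by (simp add: mix_def)
    ultimately show ?thesis by simp
  qed
  have tele: "\<bar>prb U (pins \<Lambda> (mix {})) v x - prb U (pins \<Lambda> (mix S)) v x\<bar> \<le> (\<Sum>w\<in>S. infl U w v)"
    if "finite S" "S \<subseteq> D" for S
    using that
  proof (induction S rule: finite_induct)
    case (insert w S)
    then show ?case using step[of w S] by (simp add: D_def)
  qed simp
  have "pins \<Lambda> (mix {}) = pins \<Lambda> \<sigma>" by (simp add: mix_def)
  moreover have "pins \<Lambda> (mix D) = pins \<Lambda> \<tau>"
    unfolding pins_def by (intro ext arg_cong[where f = card]) (auto simp: mix_def D_def)
  ultimately show ?thesis
    using tele[OF fin(4) order_refl] marginal_eq_prb[OF G L \<sigma> v] marginal_eq_prb[OF G L \<tau> v]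
    by (simp add: U_def D_def)
qed

end


section \<open>Reversing walks and comparing with \<open>Edelta\<close>\<close>

lemma dist_to_le:
  assumes "is_walk V E xs" "hd xs = v" "last xs \<in> D" "length xs = Suc k"
  shows "dist_to V E v D \<le> enat k"
proof -
  have "(LEAST k. \<exists>xs. is_walk V E xs \<and> hd xs = v \<and> last xs \<in> D \<and> length xs = Suc k) \<le> k"
    using assms by (intro Least_le) auto
  then show ?thesis using assms by (auto simp: dist_to_def)
qed

lemma finite_SAW:
  assumes "finite V"
  shows "finite (SAW V E v l)"
  by (rule finite_subset[OF _ finite_subset_distinct[OF assms]]) (auto simp: SAW_def is_walk_def)

lemma rev_saw_to_in_SAW:
  assumes "xs \<in> saw_to E U w v" "w \<in> V" "U \<subseteq> V"
  shows "rev (w # xs) \<in> SAW V E v (length xs)"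
proof -
  have "(\<lambda>x y. adj E y x) = adj E" by (intro ext) (rule adj_sym)
  then have "successively (adj E) (rev (w # xs))"
    using assms unfolding successively_rev by (simp only: saw_to_def mem_Collect_eq)
  then have "is_walk V E (rev (w # xs))"
    using assms unfolding is_walk_def successively_conv_nth by (auto simp: saw_to_def)
  then show ?thesis using assms by (auto simp: SAW_def saw_to_def hd_append last_rev hd_rev)
qed

lemma prod_list_tl_eq_prod:
  "length ys = Suc l \<Longrightarrow> prod_list (map f (tl ys)) = (\<Prod>i\<in>{1..l}. f (ys ! i))"
  for f :: "'a \<Rightarrow> real"
proof (induction l arbitrary: ys)
  case 0
  then show ?case by (cases ys) auto
next
  case (Suc l)
  have "ys = butlast ys @ [ys ! Suc l]"
    using Suc.prems by (metis append_butlast_last_id diff_Suc_1 last_conv_nth list.size(3) nat.distinct(1))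
  then obtain zs z where ys: "ys = zs @ [z]" by blast
  then have "length zs = Suc l" using Suc.prems by simp
  moreover from this have "(\<Prod>i\<in>{1..l}. f (ys ! i)) = (\<Prod>i\<in>{1..l}. f (zs ! i))"
    by (intro prod.cong) (auto simp: ys nth_append)
  ultimately show ?case using Suc.IH[of zs] by (cases zs) (auto simp: ys nth_append)
qed

text \<open>Reversal turns a walk from \<open>w \<in> D\<close> into one from \<open>v\<close>. The
  product over the original contains the factor of \<open>v\<close> and omits that of
  \<open>w\<close>, whereas \<open>Edelta\<close> does the opposite; the exchange costs at most the
  factor \<open>b\<close>. The length is at least 1 as \<open>v \<notin> D\<close>, below
  \<open>card V\<close> by distinctness, and at least the distance to \<open>D\<close>.\<close>

lemma sum_saw_to_le_Edelta:
  fixes \<delta> :: "nat \<Rightarrow> real"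
  assumes "finite V" and D: "D \<subseteq> V - U" and U: "U \<subseteq> V" "v \<in> U"
    and \<delta>: "0 < b" "\<And>d. b \<le> \<delta> d" "\<And>d. \<delta> d \<le> 1"
  shows "(\<Sum>w\<in>D. \<Sum>xs\<in>saw_to E U w v. prod_list (map (\<lambda>u. \<delta> (deg E u)) xs)) * b
     \<le> (\<Sum>l\<in>{l. 1 \<le> l \<and> l < card V \<and> dist_to V E v D \<le> enat l}. Edelta \<delta> V E v l)"
proof -
  define L where "L = {l. 1 \<le> l \<and> l < card V \<and> dist_to V E v D \<le> enat l}"
  define F where "F = (\<lambda>u. \<delta> (deg E u))"
  have F: "0 < F u" "b \<le> F u" "F u \<le> 1" for u
    using \<delta>(1) \<delta>(2,3)[of "deg E u"] by (auto simp: F_def)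
  have nonneg: "0 \<le> prod_list (map F zs)" for zs
    by (induction zs) (simp_all add: F less_imp_le)
  have fin: "finite D" "finite U" "finite L" using assms by (auto intro: finite_subset simp: L_def)
  have "(\<Sum>w\<in>D. \<Sum>xs\<in>saw_to E U w v. prod_list (map F xs)) * b
      = (\<Sum>(w, xs)\<in>Sigma D (\<lambda>w. saw_to E U w v). prod_list (map F xs) * b)"
    using fin by (subst sum.Sigma[symmetric]) (auto simp: finite_saw_to sum_distrib_right)
  also have "\<dots> \<le> (\<Sum>(l, ys)\<in>Sigma L (SAW V E v). \<Prod>i\<in>{1..l}. F (ys ! i))"
  \<comment> \<open>This map undoes the reversal, so distinct pairs \<open>(w, xs)\<close> are
    charged to distinct walks from \<open>v\<close>.\<close>
  proof (rule sum_le_included[where i = "\<lambda>(l, ys). (last ys, tl (rev ys))"])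
    show "finite (Sigma D (\<lambda>w. saw_to E U w v))" "finite (Sigma L (SAW V E v))"
      using fin assms(1) by (auto simp: finite_saw_to finite_SAW)
    show "\<forall>y\<in>Sigma L (SAW V E v). 0 \<le> (case y of (l, ys) \<Rightarrow> \<Prod>i\<in>{1..l}. F (ys ! i))"
      by (auto intro!: prod_nonneg simp: F less_imp_le)
    show "\<forall>x\<in>Sigma D (\<lambda>w. saw_to E U w v). \<exists>y\<in>Sigma L (SAW V E v).
        (case y of (l, ys) \<Rightarrow> (last ys, tl (rev ys))) = x \<and>
        (case x of (w, xs) \<Rightarrow> prod_list (map F xs) * b) \<le> (case y of (l, ys) \<Rightarrow> \<Prod>i\<in>{1..l}. F (ys ! i))"
    proof (clarify)
      fix w xs assume w: "w \<in> D" and xs: "xs \<in> saw_to E U w v"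
      define ys where "ys = rev (w # xs)"
      have ys: "ys \<in> SAW V E v (length xs)"
        unfolding ys_def using xs w D U by (intro rev_saw_to_in_SAW[where U = U]) auto
      have "xs \<noteq> []" using xs w D U by (auto simp: saw_to_def)
      have walk: "is_walk V E ys" "hd ys = v" "length ys = Suc (length xs)" "distinct ys"
        using ys by (auto simp: SAW_def)
      have "card (set ys) \<le> card V" using walk assms(1) by (intro card_mono) (auto simp: is_walk_def)
      then have "length xs < card V" using walk by (simp add: distinct_card)
      moreover have "dist_to V E v D \<le> enat (length xs)"
        using walk w by (intro dist_to_le[of V E ys]) (auto simp: ys_def)
      ultimately have L: "length xs \<in> L" using \<open>xs \<noteq> []\<close> by (simp add: L_def Suc_le_eq)
      have "prod_list (map F xs) * b \<le> prod_list (map F xs) * F w"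
        by (intro mult_left_mono F nonneg)
      also have "\<dots> = prod_list (map F ys)" by (simp add: ys_def prod_list.rev flip: rev_map)
      also have "\<dots> = F v * prod_list (map F (tl ys))" using walk by (cases ys) auto
      also have "\<dots> \<le> prod_list (map F (tl ys))"
        by (intro mult_left_le_one_le F nonneg less_imp_le)
      also have "\<dots> = (\<Prod>i\<in>{1..length xs}. F (ys ! i))" using walk by (intro prod_list_tl_eq_prod)
      finally have "prod_list (map F xs) * b \<le> (\<Prod>i\<in>{1..length xs}. F (ys ! i))" .
      then show "\<exists>y\<in>Sigma L (SAW V E v). (case y of (l, ys) \<Rightarrow> (last ys, tl (rev ys))) = (w, xs) \<and>
          prod_list (map F xs) * b \<le> (case y of (l, ys) \<Rightarrow> \<Prod>i\<in>{1..l}. F (ys ! i))"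
        using L ys by (intro bexI[of _ "(length xs, ys)"]) (auto simp: ys_def)
    qed
  qed
  also have "\<dots> = (\<Sum>l\<in>L. Edelta \<delta> V E v l)"
    unfolding Edelta_def F_def using fin assms(1) by (subst sum.Sigma) (auto simp: finite_SAW)
  finally show ?thesis by (simp add: L_def F_def)
qed

section \<open>Bounds for \<open>delta_potts\<close> and the limit in the activity\<close>

text \<open>Clearing the denominator in the case condition of \<open>delta_potts\<close> shows that
  the quotient used there has a positive denominator and is at most 1.\<close>

lemma delta_potts_threshold:
  fixes \<beta> :: real
  assumes "\<beta> < 1" "real d \<le> (real q - 1) / (1 - \<beta>) - 2"
  shows "2 * (1 - \<beta>) \<le> real q - 1 - (1 - \<beta>) * real d"
proof -
  have "real d + 2 \<le> (real q - 1) / (1 - \<beta>)" using assms by simp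
  then have "(real d + 2) * (1 - \<beta>) \<le> real q - 1" using assms by (simp add: pos_le_divide_eq)
  then show ?thesis by (simp add: algebra_simps)
qed

text \<open>The quotient is smallest at \<open>d = 0\<close>, which gives a lower bound independent
  of the degree.\<close>

lemma delta_potts_bounds:
  assumes "q \<ge> 3" "0 \<le> \<beta>" "\<beta> < 1"
  shows "min 1 (2 * (1 - \<beta>) / (real q - 1)) \<le> delta_potts q \<beta> d" "delta_potts q \<beta> d \<le> 1"
proof -
  have "2 * (1 - \<beta>) / (real q - 1) \<le> 2 * (1 - \<beta>) / (real q - 1 - (1 - \<beta>) * real d)
      \<and> 2 * (1 - \<beta>) / (real q - 1 - (1 - \<beta>) * real d) \<le> 1" if "real d \<le> (real q - 1) / (1 - \<beta>) - 2"
  proof -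
    note * = delta_potts_threshold[OF assms(3) that]
    have "2 * (1 - \<beta>) / (real q - 1) \<le> 2 * (1 - \<beta>) / (real q - 1 - (1 - \<beta>) * real d)"
      using * assms by (intro divide_left_mono mult_pos_pos) auto
    then show ?thesis using * assms by simp
  qed
  then show "min 1 (2 * (1 - \<beta>) / (real q - 1)) \<le> delta_potts q \<beta> d" "delta_potts q \<beta> d \<le> 1"
    by (auto simp: delta_potts_def)
qed

text \<open>The weight computed from \<open>\<beta>\<close> also dominates at every larger activity
  \<open>\<beta>' < 1\<close>: raising the activity decreases \<open>1 - \<beta>'\<close> and
  increases \<open>q - (1 - \<beta>') d\<close>.\<close>

lemma potts_delta_potts:
  assumes "q \<ge> 3" "0 \<le> \<beta>" "\<beta> \<le> \<beta>'" "0 < \<beta>'" "\<beta>' < 1"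
  shows "potts q \<beta>' (delta_potts q \<beta>)"
proof
  have b: "\<beta> < 1" using assms by simp
  fix d
  have "0 \<le> min 1 (2 * (1 - \<beta>) / (real q - 1))" using assms b by simp
  then show "0 \<le> delta_potts q \<beta> d" using delta_potts_bounds(1)[OF assms(1,2) b, of d] by linarith
  assume "delta_potts q \<beta> d < 1"
  then have d: "real d \<le> (real q - 1) / (1 - \<beta>) - 2"
    and eq: "delta_potts q \<beta> d = 2 * (1 - \<beta>) / (real q - 1 - (1 - \<beta>) * real d)"
    by (auto simp: delta_potts_def split: if_splits)
  have pos: "0 < real q - 1 - (1 - \<beta>) * real d" using delta_potts_threshold[OF b d] b by simp
  have "(1 - \<beta>') * real d \<le> (1 - \<beta>) * real d" using assms by (intro mult_right_mono) auto
  then have 1: "real q - 1 - (1 - \<beta>) * real d \<le> real q - (1 - \<beta>') * real d" by simp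
  have "(1 - \<beta>') * (real q - 1 - (1 - \<beta>) * real d) \<le> 2 * (1 - \<beta>) * (real q - (1 - \<beta>') * real d)"
    using assms b pos 1 by (intro mult_mono) auto
  then show "1 - \<beta>' \<le> delta_potts q \<beta> d * (real q - (1 - \<beta>') * real d)"
    unfolding eq using pos by (simp add: pos_le_divide_eq)
qed (use assms in auto)

lemma partition_fn_pos:
  assumes "finite V" "0 \<le> \<beta>" "feasible q \<beta> V E \<Lambda> \<sigma>"
  shows "partition_fn q \<beta> V E \<Lambda> \<sigma> > 0"
proof -
  obtain \<pi> where "\<pi> \<in> configs q V" "potts_weight \<beta> E \<Lambda> \<sigma> \<pi> > 0"
    using assms by (auto simp: feasible_def)
  then show ?thesis unfolding partition_fn_def using assms
    by (intro sum_pos2[of _ \<pi>]) (auto simp: finite_configs potts_weight_def)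
qed

lemma isCont_marginal:
  assumes "partition_fn q \<beta> V E \<Lambda> \<sigma> \<noteq> 0"
  shows "isCont (\<lambda>\<beta>. marginal q \<beta> V E \<Lambda> \<sigma> v x) \<beta>"
proof -
  have "isCont (\<lambda>\<beta>. potts_weight \<beta> E \<Lambda> \<sigma> \<pi>) \<beta>" for \<pi>
  proof (cases "\<forall>u\<in>\<Lambda>. \<pi> u = \<sigma> u")
    case False
    then have "(\<lambda>\<beta>. potts_weight \<beta> E \<Lambda> \<sigma> \<pi>) = (\<lambda>_. 0)" 
      unfolding potts_weight_def if_not_P[OF False] by simp
    then show ?thesis by simp
  qed (simp add: potts_weight_def)
  then show ?thesis
    using assms unfolding marginal_def partition_fn_def by (intro isCont_divide isCont_sum ballI)
qed

text \<open>The bound holds at each \<open>\<beta>'\<close> in \<open>(\<beta>, 1)\<close> with a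
  right-hand side that does not depend on \<open>\<beta>'\<close>, so it passes to the limit from
  the right. Feasibility keeps both partition functions nonzero at \<open>\<beta>\<close>.\<close>

lemma marginal_diff_le_saw:
  assumes "q \<ge> 3" "0 \<le> \<beta>" "\<beta> < 1" and G: "graph V E" and L: "\<Lambda> \<subseteq> V"
    and \<sigma>: "\<forall>u\<in>\<Lambda>. \<sigma> u \<in> {1..q}" and \<tau>: "\<forall>u\<in>\<Lambda>. \<tau> u \<in> {1..q}"
    and feas: "feasible q \<beta> V E \<Lambda> \<sigma>" "feasible q \<beta> V E \<Lambda> \<tau>" and v: "v \<in> V - \<Lambda>"
  shows "\<bar>marginal q \<beta> V E \<Lambda> \<sigma> v x - marginal q \<beta> V E \<Lambda> \<tau> v x\<bar>
     \<le> (\<Sum>w\<in>{u\<in>\<Lambda>. \<sigma> u \<noteq> \<tau> u}. \<Sum>xs\<in>saw_to E (V - \<Lambda>) w v.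
           prod_list (map (\<lambda>u. delta_potts q \<beta> (deg E u)) xs))" (is "?f \<beta> \<le> ?R")
proof -
  have fV: "finite V" using G by (simp add: graph_def)
  have "(\<lambda>\<beta>. ?f \<beta>) \<midarrow>\<beta>\<rightarrow> ?f \<beta>"
    using partition_fn_pos[OF fV assms(2) feas(1)] partition_fn_pos[OF fV assms(2) feas(2)]
    by (intro tendsto_intros isContD isCont_marginal) auto
  then have lim: "(?f \<longlongrightarrow> ?f \<beta>) (at_right \<beta>)"
    by (rule filterlim_at_split[THEN iffD1, THEN conjunct2])
  have "\<forall>\<^sub>F \<beta>' in at_right \<beta>. \<beta>' \<in> {\<beta><..<1}"
    using assms(3) by (intro eventually_at_rightI[of \<beta> 1]) auto
  then have "\<forall>\<^sub>F \<beta>' in at_right \<beta>. ?f \<beta>' \<le> ?R"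
  proof eventually_elim
    case (elim \<beta>')
    interpret potts q \<beta>' E "delta_potts q \<beta>"
      using elim assms by (intro potts_delta_potts) auto
    show ?case using marginal_diff_le_infl[OF G L \<sigma> \<tau> v, of x] by (simp add: infl_def)
  qed
  then show ?thesis by (intro tendsto_upperbound[OF lim]) auto
qed

section \<open>Assembling the mixing bound\<close>

text \<open>There are fewer than \<open>card V\<close> relevant lengths, each at least
  \<open>k\<close>, so each power of \<open>\<gamma>\<close> is at most
  \<open>epow \<gamma> k\<close>. For \<open>k = \<infinity>\<close> no length qualifies and both
  sides vanish.\<close>

lemma sum_Edelta_le_epow:
  assumes "0 < \<gamma>" "\<gamma> < 1"
    and E: "\<And>l. l \<ge> 1 \<Longrightarrow> Edelta \<delta> V E v l < real (card V) powr C * \<gamma> ^ l"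
  shows "(\<Sum>l\<in>{l. 1 \<le> l \<and> l < card V \<and> k \<le> enat l}. Edelta \<delta> V E v l)
    \<le> real (card V) * (real (card V) powr C * epow \<gamma> k)" (is "sum _ ?L \<le> _")
proof (cases k)
  case (enat j)
  have "(\<Sum>l\<in>?L. Edelta \<delta> V E v l) \<le> (\<Sum>l\<in>?L. real (card V) powr C * \<gamma> ^ j)"
  proof (rule sum_mono)
    fix l assume l: "l \<in> ?L"
    then have "\<gamma> ^ l \<le> \<gamma> ^ j" using assms enat by (intro power_decreasing) auto
    then have "real (card V) powr C * \<gamma> ^ l \<le> real (card V) powr C * \<gamma> ^ j" by (intro mult_left_mono) auto
    moreover have "Edelta \<delta> V E v l < real (card V) powr C * \<gamma> ^ l" using E[of l] l by blast
    ultimately show "Edelta \<delta> V E v l \<le> real (card V) powr C * \<gamma> ^ j" by linarith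
  qed
  also have "\<dots> \<le> real (card V) * (real (card V) powr C * \<gamma> ^ j)"
  proof -
    have "card ?L \<le> card {..<card V}" by (intro card_mono) auto
    then show ?thesis using assms by (simp add: mult_right_mono)
  qed
  finally show ?thesis by (simp add: enat epow_def)
qed (simp add: epow_def)

lemma abs_marginal_diff_le_1:
  assumes "0 \<le> \<beta>" "finite V"
  shows "\<bar>marginal q \<beta> V E \<Lambda> \<sigma> v x - marginal q \<beta> V E \<Lambda> \<tau> v x\<bar> \<le> 1"
proof -
  have "0 \<le> marginal q \<beta> V E \<Lambda> \<rho> v x \<and> marginal q \<beta> V E \<Lambda> \<rho> v x \<le> 1" for \<rho>
  proof -
    have w: "0 \<le> potts_weight \<beta> E \<Lambda> \<rho> \<pi>" for \<pi> using assms by (simp add: potts_weight_def)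
    have "(\<Sum>\<pi>\<in>{\<pi>\<in>configs q V. \<pi> v = x}. potts_weight \<beta> E \<Lambda> \<rho> \<pi>) \<le> partition_fn q \<beta> V E \<Lambda> \<rho>"
      unfolding partition_fn_def using w assms by (intro sum_mono2) (auto simp: finite_configs)
    moreover have "0 \<le> (\<Sum>\<pi>\<in>{\<pi>\<in>configs q V. \<pi> v = x}. potts_weight \<beta> E \<Lambda> \<rho> \<pi>)"
      using w by (intro sum_nonneg) auto
    \<comment> \<open>A vanishing partition function makes the quotient 0, which is within the
      bounds.\<close>
    ultimately show ?thesis unfolding marginal_def by (auto intro: divide_nonneg_nonneg divide_le_eq_1[THEN iffD2])
  qed
  from this[of \<sigma>] this[of \<tau>] show ?thesis by linarith
qed

lemma marginal_pinned:
  assumes "finite V" "0 \<le> \<beta>" "feasible q \<beta> V E \<Lambda> \<sigma>" "v \<in> \<Lambda>"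
  shows "marginal q \<beta> V E \<Lambda> \<sigma> v x = (if \<sigma> v = x then 1 else 0)"
proof -
  have "(\<Sum>\<pi>\<in>{\<pi>\<in>configs q V. \<pi> v = x}. potts_weight \<beta> E \<Lambda> \<sigma> \<pi>)
    = (if \<sigma> v = x then partition_fn q \<beta> V E \<Lambda> \<sigma> else 0)"
  proof (cases "\<sigma> v = x")
    case True
    then show ?thesis unfolding partition_fn_def using assms
      by (auto intro!: sum.mono_neutral_left simp: finite_configs potts_weight_def split: if_splits)
  next
    case False
    then show ?thesis using assms by (auto intro!: sum.neutral simp: potts_weight_def)
  qed
  then show ?thesis using partition_fn_pos[OF assms(1-3)] by (simp add: marginal_def)
qed

theorem mainTheorem2:
  fixes q :: nat and \<beta> :: real and \<G> :: "('a set \<times> 'a set set) set"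
  assumes "q \<ge> 3" and "0 \<le> \<beta>" and "\<beta> < 1"
    and "\<forall>(V, E)\<in>\<G>. graph V E"
    and "contraction_function (delta_potts q \<beta>) \<G>"
    and "\<beta> = 0 \<longrightarrow> (\<forall>(V, E)\<in>\<G>. proper_colorable q V E)"
  shows "\<exists>C::real. \<exists>\<gamma>::real. C > 0 \<and> 0 < \<gamma> \<and> \<gamma> < 1 \<and>
    (\<forall>(V, E)\<in>\<G>. \<forall>v\<in>V. \<forall>\<Lambda> \<subseteq> V. \<forall>x\<in>{1..q}. \<forall>\<sigma> \<tau>.
       (\<forall>u\<in>\<Lambda>. \<sigma> u \<in> {1..q}) \<longrightarrow> (\<forall>u\<in>\<Lambda>. \<tau> u \<in> {1..q}) \<longrightarrow>
       feasible q \<beta> V E \<Lambda> \<sigma> \<longrightarrow> feasible q \<beta> V E \<Lambda> \<tau> \<longrightarrow>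
       \<bar>marginal q \<beta> V E \<Lambda> \<sigma> v x - marginal q \<beta> V E \<Lambda> \<tau> v x\<bar>
         \<le> real (card V) powr C * epow \<gamma> (dist_to V E v {u\<in>\<Lambda>. \<sigma> u \<noteq> \<tau> u}))"
proof -
  obtain C \<gamma> where C: "C > 0" and \<gamma>: "0 < \<gamma>" "\<gamma> < 1" and *: "\<forall>(V, E)\<in>\<G>. \<forall>v\<in>V. \<forall>l\<ge>1.
      Edelta (delta_potts q \<beta>) V E v l < real (card V) powr C * \<gamma> ^ l"
    using assms(5) unfolding contraction_function_def by blast
  have contr: "Edelta (delta_potts q \<beta>) V E v l < real (card V) powr C * \<gamma> ^ l"
    if "(V, E) \<in> \<G>" "v \<in> V" "l \<ge> 1" for V E v l using bspec[OF * that(1)] that(2,3) by blast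
  \<comment> \<open>The uniform lower bound on \<open>delta_potts\<close>, which is the price of
    exchanging the ends of a walk.\<close>
  define b where "b = min 1 (2 * (1 - \<beta>) / (real q - 1))"
  have b: "0 < b" "b \<le> 1" using assms(1-3) by (auto simp: b_def)
  \<comment> \<open>The 1 accounts for the number of lengths, \<open>C\<close> comes from the
    contraction, and the logarithm absorbs \<open>1 / b\<close> once
    \<open>n \<ge> 2\<close>.\<close>
  define C' where "C' = 1 + C + log 2 (1 / b)"
  have C': "C' > 0" using C b by (simp add: C'_def add_pos_nonneg)
  have epow_nonneg: "0 \<le> epow \<gamma> k" for k using \<gamma> by (simp add: epow_def split: enat.split)
  have "\<bar>marginal q \<beta> V E \<Lambda> \<sigma> v x - marginal q \<beta> V E \<Lambda> \<tau> v x\<bar>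
         \<le> real (card V) powr C' * epow \<gamma> (dist_to V E v {u\<in>\<Lambda>. \<sigma> u \<noteq> \<tau> u})"
    if VE: "(V, E) \<in> \<G>" and v: "v \<in> V" and L: "\<Lambda> \<subseteq> V"
      and \<sigma>: "\<forall>u\<in>\<Lambda>. \<sigma> u \<in> {1..q}" and \<tau>: "\<forall>u\<in>\<Lambda>. \<tau> u \<in> {1..q}"
      and feas: "feasible q \<beta> V E \<Lambda> \<sigma>" "feasible q \<beta> V E \<Lambda> \<tau>"
    for V :: "'a set" and E v \<Lambda> x \<sigma> \<tau>
  proof -
    define D where "D = {u\<in>\<Lambda>. \<sigma> u \<noteq> \<tau> u}"
    define n where "n = real (card V)"
    have G: "graph V E" using assms(4) VE by auto
    then have fV: "finite V" by (simp add: graph_def)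
    then have n1: "n \<ge> 1" using v by (auto simp: n_def Suc_le_eq card_gt_0_iff)
    consider "v \<in> D" | "v \<in> \<Lambda>" "v \<notin> D" | "D = {}" "v \<notin> \<Lambda>" | "v \<notin> \<Lambda>" "D \<noteq> {}" by blast
    then show ?thesis
    proof cases
      case 1
      \<comment> \<open>At distance 0 the bound is at least 1, so the trivial estimate
        suffices.\<close>
      have "dist_to V E v D \<le> enat 0"
        using 1 v by (intro dist_to_le[of V E "[v]"]) (auto simp: is_walk_def)
      then have "dist_to V E v D = enat 0" by (simp flip: zero_enat_def)
      then have "epow \<gamma> (dist_to V E v D) = 1" by (simp add: epow_def)
      moreover have "1 \<le> n powr C'" using n1 C' by (simp add: ge_one_powr_ge_zero)
      ultimately show ?thesis
        using abs_marginal_diff_le_1[OF assms(2) fV, of q E \<Lambda> \<sigma> v x \<tau>] by (simp add: D_def n_def)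
    next
      case 2
      then have "marginal q \<beta> V E \<Lambda> \<sigma> v x = marginal q \<beta> V E \<Lambda> \<tau> v x"
        using marginal_pinned[OF fV assms(2)] feas by (simp add: D_def)
      then show ?thesis using epow_nonneg by simp
    next
      case 3
      then have "\<bar>marginal q \<beta> V E \<Lambda> \<sigma> v x - marginal q \<beta> V E \<Lambda> \<tau> v x\<bar> \<le> 0"
        using marginal_diff_le_saw[OF assms(1-3) G L \<sigma> \<tau> feas, of v x, folded D_def] v by simp
      also have "0 \<le> n powr C' * epow \<gamma> (dist_to V E v {u\<in>\<Lambda>. \<sigma> u \<noteq> \<tau> u})" using epow_nonneg by simp
      finally show ?thesis by (simp add: n_def)
    next
      case 4
      \<comment> \<open>A disagreeing vertex is pinned and \<open>v\<close> is not, so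
        \<open>V\<close> has at least two vertices, as absorbing \<open>1 / b\<close>
        requires.\<close>
      then obtain w where w: "w \<in> V" "w \<noteq> v" using L by (auto simp: D_def)
      have "card {v, w} \<le> card V" using w v fV by (intro card_mono) auto
      then have n2: "n \<ge> 2" using w by (simp add: n_def)
      let ?d = "\<bar>marginal q \<beta> V E \<Lambda> \<sigma> v x - marginal q \<beta> V E \<Lambda> \<tau> v x\<bar>"
      have "?d * b \<le> (\<Sum>w\<in>D. \<Sum>xs\<in>saw_to E (V - \<Lambda>) w v.
           prod_list (map (\<lambda>u. delta_potts q \<beta> (deg E u)) xs)) * b"
        unfolding D_def using marginal_diff_le_saw[OF assms(1-3) G L \<sigma> \<tau> feas, of v x] v 4 b
        by (intro mult_right_mono) auto
      also have "\<dots> \<le> (\<Sum>l\<in>{l. 1 \<le> l \<and> l < card V \<and> dist_to V E v D \<le> enat l}. Edelta (delta_potts q \<beta>) V E v l)"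
        using fV L v 4 b delta_potts_bounds[OF assms(1-3)]
        by (intro sum_saw_to_le_Edelta) (auto simp: D_def b_def)
      also have "\<dots> \<le> n * (n powr C * epow \<gamma> (dist_to V E v D))"
        unfolding n_def using \<gamma> contr[OF VE v] by (intro sum_Edelta_le_epow) auto
      finally have "?d \<le> 1 / b * (n * (n powr C * epow \<gamma> (dist_to V E v D)))"
        using b by (simp add: field_simps)
      also have "\<dots> \<le> n powr (log 2 (1 / b)) * (n * (n powr C * epow \<gamma> (dist_to V E v D)))"
      proof (rule mult_right_mono)
        have "1 / b = 2 powr (log 2 (1 / b))" using b by simp
        also have "\<dots> \<le> n powr (log 2 (1 / b))" using n2 b by (intro powr_mono2) auto
        finally show "1 / b \<le> n powr (log 2 (1 / b))" .
      qed (use n1 epow_nonneg in auto)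
      also have "\<dots> = n powr C' * epow \<gamma> (dist_to V E v D)"
        using n1 by (simp add: C'_def powr_add)
      finally show ?thesis by (simp add: D_def n_def)
    qed
  qed
  then show ?thesis using C' \<gamma> by (intro exI[of _ C'] exI[of _ \<gamma>]) auto
qed

end
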